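(* Let $\Bbbk$ be a field and let $A$ be a $2$-dimensional vector space over $\Bbbk$ with basis $x,y$, equipped with the comultiplication (linear map $\Delta\colon A\to A\otimes A$) given by $$\Delta x = 0,\qquad \Delta y = y\otimes y .$$ Then each of the following bilinear multiplications on $A$ makes $A$ into a non-counital self-distributive bialgebra: (i) $x^2=0,\ xy=0,\ yx=bx,\ y^2=0$, where $b\in\Bbbk$; (ii) $x^2=0,\ xy=cx,\ yx=0,\ y^2=y$, where $c\in\Bbbk$.
   Context: Algebras are $\Bbbk$-vector spaces with a bilinear multiplication, not assumed associative or unital. A comultiplication on a vector space $A$ is a linear map $\Delta\colon A\to A\otimes A$; it is coassociative if $(\Delta\otimes\mathrm{id})\circ\Delta=(\mathrm{id}\otimes\Delta)\circ\Delta$. A counit for $(A,\Delta)$ is a linear map $\varepsilon\colon A\to\Bbbk$ with $(\varepsilon\otimes\mathrm{id})\circ\Delta=(\mathrm{id}\otimes\varepsilon)\circ\Delta=\mathrm{id}$ (identifying $\Bbbk\otimes A\cong A\cong A\otimes\Bbbk$). Non-counital means that no counit exists. A bialgebra is a vector space $A$ with a bilinear multiplication and a coassociative comultiplication $\Delta$ such that $\Delta(ab)=\Delta(a)\Delta(b)$ for all $a,b\in A$, where $A\otimes A$ has the component-wise product $(a\otimes b)(a'\otimes b')=aa'\otimes bb'$. In Sweedler notation $\Delta(c)=c^{(1)}\otimes c^{(2)}$ (summation understood), a bialgebra is self-distributive if $(ab)c=(ac^{(1)})(bc^{(2)})$ for all $a,b,c\in A$. *)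

theory Defs
  imports "HOL-Algebra.AbelCoset" "Jordan_Normal_Form.Missing_VectorSpace"
begin

section \<open>Tensor products of vector spaces\<close>

text \<open>
  The usual construction: the free vector space on the set of pairs, modulo the subspace spanned
  by the bilinearity relators.  Modules are HOL-Algebra records, which also carry the fields
  \<open>mult\<close> and \<open>one\<close>; these are junk in the modules constructed here, and in particular
  have nothing to do with the multiplication of a bialgebra.
\<close>

definition free_module :: "('k, 'm) ring_scheme \<Rightarrow> 's set \<Rightarrow> ('k, 's \<Rightarrow> 'k) module" where
  "free_module K S = (ring.func_space K S)
     \<lparr>carrier := {u \<in> S \<rightarrow>\<^sub>E carrier K. finite {s \<in> S. u s \<noteq> \<zero>\<^bsub>K\<^esub>}}\<rparr>"

definition free_gen :: "('k, 'm) ring_scheme \<Rightarrow> 's set \<Rightarrow> 's \<Rightarrow> 's \<Rightarrow> 'k" where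
  "free_gen K S s = (\<lambda>t\<in>S. if t = s then \<one>\<^bsub>K\<^esub> else \<zero>\<^bsub>K\<^esub>)"

definition quotient_module ::
    "('k, 'a, 'n) module_scheme \<Rightarrow> 'a set \<Rightarrow> ('k, 'a set) module" where
  "quotient_module M N =
     \<lparr>carrier = a_rcosets\<^bsub>M\<^esub> N, mult = undefined, one = undefined,
      zero = N, add = set_add M, smult = (\<lambda>r X. \<Union>v\<in>X. N +>\<^bsub>M\<^esub> (r \<odot>\<^bsub>M\<^esub> v))\<rparr>"

definition tensor_free ::
    "('k, 'm) ring_scheme \<Rightarrow> ('k, 'a, 'n) module_scheme \<Rightarrow> ('k, 'b, 'p) module_scheme
     \<Rightarrow> ('k, 'a \<times> 'b \<Rightarrow> 'k) module" where
  "tensor_free K A B = free_module K (carrier A \<times> carrier B)"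

definition tensor_relators ::
    "('k, 'm) ring_scheme \<Rightarrow> ('k, 'a, 'n) module_scheme \<Rightarrow> ('k, 'b, 'p) module_scheme
     \<Rightarrow> ('a \<times> 'b \<Rightarrow> 'k) set" where
  "tensor_relators K A B =
     (let F = tensor_free K A B; g = (\<lambda>a b. free_gen K (carrier A \<times> carrier B) (a, b)) in
        {g (a \<oplus>\<^bsub>A\<^esub> a') b \<ominus>\<^bsub>F\<^esub> (g a b \<oplus>\<^bsub>F\<^esub> g a' b) | a a' b.
           a \<in> carrier A \<and> a' \<in> carrier A \<and> b \<in> carrier B}
      \<union> {g a (b \<oplus>\<^bsub>B\<^esub> b') \<ominus>\<^bsub>F\<^esub> (g a b \<oplus>\<^bsub>F\<^esub> g a b') | a b b'.
           a \<in> carrier A \<and> b \<in> carrier B \<and> b' \<in> carrier B}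
      \<union> {g (r \<odot>\<^bsub>A\<^esub> a) b \<ominus>\<^bsub>F\<^esub> (r \<odot>\<^bsub>F\<^esub> g a b) | r a b.
           r \<in> carrier K \<and> a \<in> carrier A \<and> b \<in> carrier B}
      \<union> {g a (r \<odot>\<^bsub>B\<^esub> b) \<ominus>\<^bsub>F\<^esub> (r \<odot>\<^bsub>F\<^esub> g a b) | r a b.
           r \<in> carrier K \<and> a \<in> carrier A \<and> b \<in> carrier B})"

definition tensor_kernel ::
    "('k, 'm) ring_scheme \<Rightarrow> ('k, 'a, 'n) module_scheme \<Rightarrow> ('k, 'b, 'p) module_scheme
     \<Rightarrow> ('a \<times> 'b \<Rightarrow> 'k) set" where
  "tensor_kernel K A B = module.span K (tensor_free K A B) (tensor_relators K A B)"

definition tensor ::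
    "('k, 'm) ring_scheme \<Rightarrow> ('k, 'a, 'n) module_scheme \<Rightarrow> ('k, 'b, 'p) module_scheme
     \<Rightarrow> ('k, ('a \<times> 'b \<Rightarrow> 'k) set) module" where
  "tensor K A B = quotient_module (tensor_free K A B) (tensor_kernel K A B)"

definition pure_tensor ::
    "('k, 'm) ring_scheme \<Rightarrow> ('k, 'a, 'n) module_scheme \<Rightarrow> ('k, 'b, 'p) module_scheme
     \<Rightarrow> 'a \<Rightarrow> 'b \<Rightarrow> ('a \<times> 'b \<Rightarrow> 'k) set" where
  "pure_tensor K A B a b =
     tensor_kernel K A B +>\<^bsub>tensor_free K A B\<^esub> free_gen K (carrier A \<times> carrier B) (a, b)"

definition bilinear_map ::
    "('k, 'm) ring_scheme \<Rightarrow> ('k, 'a, 'n) module_scheme \<Rightarrow> ('k, 'b, 'p) module_scheme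
     \<Rightarrow> ('k, 'c, 'q) module_scheme \<Rightarrow> ('a \<Rightarrow> 'b \<Rightarrow> 'c) \<Rightarrow> bool" where
  "bilinear_map K A B P f \<longleftrightarrow>
     (\<forall>a\<in>carrier A. (\<lambda>b. f a b) \<in> module_hom K B P) \<and>
     (\<forall>b\<in>carrier B. (\<lambda>a. f a b) \<in> module_hom K A P)"

text \<open>
  The map \<open>A \<otimes> B \<rightarrow> P\<close> induced by \<open>f\<close>, i.e. \<open>\<Sum> a\<^sub>i \<otimes> b\<^sub>i \<mapsto> \<Sum> f a\<^sub>i b\<^sub>i\<close>.
  For bilinear \<open>f\<close> the linear extension of \<open>f\<close> to formal sums is constant on each coset \<open>t\<close>, so
  that its image of \<open>t\<close> is a singleton; the definition is only meant for such \<open>f\<close>.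
\<close>

definition tensor_lift ::
    "('k, 'm) ring_scheme \<Rightarrow> ('k, 'a, 'n) module_scheme \<Rightarrow> ('k, 'b, 'p) module_scheme
     \<Rightarrow> ('k, 'c, 'q) module_scheme \<Rightarrow> ('a \<Rightarrow> 'b \<Rightarrow> 'c) \<Rightarrow> ('a \<times> 'b \<Rightarrow> 'k) set \<Rightarrow> 'c" where
  "tensor_lift K A B P f t =
     the_elem ((\<lambda>u. \<Oplus>\<^bsub>P\<^esub>s \<in> {s \<in> carrier A \<times> carrier B. u s \<noteq> \<zero>\<^bsub>K\<^esub>}.
                       u s \<odot>\<^bsub>P\<^esub> f (fst s) (snd s)) ` t)"

definition tensor_map ::
    "('k, 'm) ring_scheme \<Rightarrow> ('k, 'a, 'n) module_scheme \<Rightarrow> ('k, 'b, 'p) module_scheme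
     \<Rightarrow> ('k, 'c, 'q) module_scheme \<Rightarrow> ('k, 'd, 'r) module_scheme
     \<Rightarrow> ('a \<Rightarrow> 'c) \<Rightarrow> ('b \<Rightarrow> 'd) \<Rightarrow> ('a \<times> 'b \<Rightarrow> 'k) set \<Rightarrow> ('c \<times> 'd \<Rightarrow> 'k) set" where
  "tensor_map K A B C D f g =
     tensor_lift K A B (tensor K C D) (\<lambda>a b. pure_tensor K C D (f a) (g b))"

text \<open>The canonical isomorphism \<open>(A \<otimes> B) \<otimes> C \<rightarrow> A \<otimes> (B \<otimes> C)\<close>.\<close>

definition tensor_assoc ::
    "('k, 'm) ring_scheme \<Rightarrow> ('k, 'a, 'n) module_scheme \<Rightarrow> ('k, 'b, 'p) module_scheme
     \<Rightarrow> ('k, 'c, 'q) module_scheme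
     \<Rightarrow> (('a \<times> 'b \<Rightarrow> 'k) set \<times> 'c \<Rightarrow> 'k) set \<Rightarrow> ('a \<times> ('b \<times> 'c \<Rightarrow> 'k) set \<Rightarrow> 'k) set" where
  "tensor_assoc K A B C =
     (let P = tensor K A (tensor K B C) in
        tensor_lift K (tensor K A B) C P
          (\<lambda>t c. tensor_lift K A B P
             (\<lambda>a b. pure_tensor K A (tensor K B C) a (pure_tensor K B C b c)) t))"

definition scalar_module :: "('k, 'm) ring_scheme \<Rightarrow> ('k, 'k) module" where
  "scalar_module K =
     \<lparr>carrier = carrier K, mult = undefined, one = undefined,
      zero = \<zero>\<^bsub>K\<^esub>, add = add K, smult = mult K\<rparr>"

text \<open>The canonical isomorphisms \<open>K \<otimes> A \<rightarrow> A\<close> and \<open>A \<otimes> K \<rightarrow> A\<close>.\<close>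

definition tensor_lunit ::
    "('k, 'm) ring_scheme \<Rightarrow> ('k, 'a, 'n) module_scheme \<Rightarrow> ('k \<times> 'a \<Rightarrow> 'k) set \<Rightarrow> 'a" where
  "tensor_lunit K A = tensor_lift K (scalar_module K) A A (\<lambda>r a. r \<odot>\<^bsub>A\<^esub> a)"

definition tensor_runit ::
    "('k, 'm) ring_scheme \<Rightarrow> ('k, 'a, 'n) module_scheme \<Rightarrow> ('a \<times> 'k \<Rightarrow> 'k) set \<Rightarrow> 'a" where
  "tensor_runit K A = tensor_lift K A (scalar_module K) A (\<lambda>a r. r \<odot>\<^bsub>A\<^esub> a)"


section \<open>Comultiplications, counits and bialgebras\<close>

definition coassociative ::
    "('k, 'm) ring_scheme \<Rightarrow> ('k, 'a, 'n) module_scheme \<Rightarrow> ('a \<Rightarrow> ('a \<times> 'a \<Rightarrow> 'k) set) \<Rightarrow> bool"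
  where
  "coassociative K A \<Delta> \<longleftrightarrow>
     (\<forall>a\<in>carrier A.
        tensor_assoc K A A A (tensor_map K A A (tensor K A A) A \<Delta> id (\<Delta> a))
        = tensor_map K A A A (tensor K A A) id \<Delta> (\<Delta> a))"

definition is_counit ::
    "('k, 'm) ring_scheme \<Rightarrow> ('k, 'a, 'n) module_scheme \<Rightarrow> ('a \<Rightarrow> ('a \<times> 'a \<Rightarrow> 'k) set)
     \<Rightarrow> ('a \<Rightarrow> 'k) \<Rightarrow> bool" where
  "is_counit K A \<Delta> \<epsilon> \<longleftrightarrow>
     \<epsilon> \<in> module_hom K A (scalar_module K) \<and>
     (\<forall>a\<in>carrier A.
        tensor_lunit K A (tensor_map K A A (scalar_module K) A \<epsilon> id (\<Delta> a)) = a \<and>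
        tensor_runit K A (tensor_map K A A A (scalar_module K) id \<epsilon> (\<Delta> a)) = a)"

definition counital ::
    "('k, 'm) ring_scheme \<Rightarrow> ('k, 'a, 'n) module_scheme \<Rightarrow> ('a \<Rightarrow> ('a \<times> 'a \<Rightarrow> 'k) set) \<Rightarrow> bool"
  where
  "counital K A \<Delta> \<longleftrightarrow> (\<exists>\<epsilon>. is_counit K A \<Delta> \<epsilon>)"

text \<open>The component-wise product \<open>(a \<otimes> b)(a' \<otimes> b') = aa' \<otimes> bb'\<close> on \<open>A \<otimes> A\<close>, extended bilinearly.\<close>

definition tensor_mult ::
    "('k, 'm) ring_scheme \<Rightarrow> ('k, 'a, 'n) module_scheme \<Rightarrow> ('a \<Rightarrow> 'a \<Rightarrow> 'a)
     \<Rightarrow> ('a \<times> 'a \<Rightarrow> 'k) set \<Rightarrow> ('a \<times> 'a \<Rightarrow> 'k) set \<Rightarrow> ('a \<times> 'a \<Rightarrow> 'k) set" where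
  "tensor_mult K A \<mu> s t =
     tensor_lift K A A (tensor K A A)
       (\<lambda>a b. tensor_lift K A A (tensor K A A)
          (\<lambda>a' b'. pure_tensor K A A (\<mu> a a') (\<mu> b b')) t) s"

locale bialgebra = vectorspace K A
  for K :: "('k, 'm) ring_scheme" and A :: "('k, 'a, 'n) module_scheme" +
  fixes \<mu> :: "'a \<Rightarrow> 'a \<Rightarrow> 'a" and \<Delta> :: "'a \<Rightarrow> ('a \<times> 'a \<Rightarrow> 'k) set"
  assumes mult_bilinear: "bilinear_map K A A A \<mu>"
    and comult_linear: "\<Delta> \<in> module_hom K A (tensor K A A)"
    and comult_coassoc: "coassociative K A \<Delta>"
    and comult_mult: "\<lbrakk>a \<in> carrier A; b \<in> carrier A\<rbrakk>
          \<Longrightarrow> \<Delta> (\<mu> a b) = tensor_mult K A \<mu> (\<Delta> a) (\<Delta> b)"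

text \<open>
  The right-hand side of the axiom below is the image of \<open>\<Delta> c\<close> under the map \<open>A \<otimes> A \<rightarrow> A\<close>
  induced by \<open>(u, v) \<mapsto> (au)(bv)\<close>, which is \<open>(ac\<^sup>1)(bc\<^sup>2)\<close> in Sweedler notation.
\<close>

locale self_distributive_bialgebra = bialgebra +
  assumes self_distributive: "\<lbrakk>a \<in> carrier A; b \<in> carrier A; c \<in> carrier A\<rbrakk>
    \<Longrightarrow> \<mu> (\<mu> a b) c = tensor_lift K A A A (\<lambda>u v. \<mu> (\<mu> a u) (\<mu> b v)) (\<Delta> c)"

end

theory Submission
  imports Defs
begin

text \<open>
  Because \<open>\<Delta>\<close> kills \<open>x\<close> and \<open>y\<close> is grouplike, every axiom becomes a short list of equations between
  products of the basis vectors.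

  Coassociativity holds for this \<open>\<Delta>\<close> whatever the multiplication is.  Compatibility of \<open>\<Delta>\<close> with the
  product requires the three products involving \<open>x\<close> to lie in the kernel of \<open>\<Delta>\<close>
  and \<open>y\<^sup>2\<close> to satisfy \<open>\<Delta>(y\<^sup>2) = y\<^sup>2 \<otimes> y\<^sup>2\<close>.  Self-distributivity says that
  \<open>(ab)x = 0\<close> and \<open>(ab)y = (ay)(by)\<close> for basis vectors \<open>a\<close>, \<open>b\<close>.  This is the lemma
  \<open>self_distributive_bialgebra_criterion\<close>, and both multiplication tables satisfy its
  hypotheses at sight.  There is no counit since \<open>\<Delta>\<close> is not injective
  (\<open>not_counital_if_comult_kernel\<close>).

  What takes work is that passing to basis vectors presupposes that all the maps involved are well
  defined and linear.  The tensor product is a quotient of a free module, so this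
  amounts to its universal property: the pure tensor is bilinear (\<open>pure_tensor_bilinear\<close>), and a
  bilinear map lifts to a linear map with the expected values on pure tensors (\<open>tensor_lift_hom\<close>,
  \<open>tensor_lift_pure\<close>).  The associator and the product on \<open>A \<otimes> A\<close> are lifts of maps that are
  themselves given by lifts; for these, linearity of the lift in the lifted map is also needed
  (\<open>tensor_lift_param_hom\<close>).
\<close>

section \<open>Linear and bilinear maps\<close>

lemma module_homI:
  assumes "\<And>u. u \<in> carrier M \<Longrightarrow> f u \<in> carrier N"
    and "\<And>u v. u \<in> carrier M \<Longrightarrow> v \<in> carrier M \<Longrightarrow> f (u \<oplus>\<^bsub>M\<^esub> v) = f u \<oplus>\<^bsub>N\<^esub> f v"
    and "\<And>r u. r \<in> carrier R \<Longrightarrow> u \<in> carrier M \<Longrightarrow> f (r \<odot>\<^bsub>M\<^esub> u) = r \<odot>\<^bsub>N\<^esub> f u"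
  shows "f \<in> module_hom R M N"
  using assms by (simp add: module_hom_def)

lemma module_hom_carrier: "f \<in> module_hom R M N \<Longrightarrow> u \<in> carrier M \<Longrightarrow> f u \<in> carrier N"
  by (auto simp: module_hom_def)

lemma module_hom_zero:
  assumes "module R M" "module R N" "f \<in> module_hom R M N"
  shows "f \<zero>\<^bsub>M\<^esub> = \<zero>\<^bsub>N\<^esub>"
proof -
  interpret mod_hom R M N f using assms by (simp add: mod_hom_def mod_hom_axioms_def)
  show ?thesis by (rule f0_is_0)
qed

lemma module_hom_id: "id \<in> module_hom R M M"
  by (rule module_homI) auto

lemma module_hom_compose:
  "f \<in> module_hom R M N \<Longrightarrow> g \<in> module_hom R N P \<Longrightarrow> (\<lambda>u. g (f u)) \<in> module_hom R M P"
  by (rule module_homI) (simp_all add: module_hom_carrier module_hom_add module_hom_smult)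

lemma module_hom_const_zero:
  assumes "module R N"
  shows "(\<lambda>u. \<zero>\<^bsub>N\<^esub>) \<in> module_hom R M N"
proof -
  interpret module R N by fact
  show ?thesis by (rule module_homI) auto
qed

text \<open>
  All axioms of a bialgebra are equations between linear or bilinear maps, so this and the next
  lemma reduce them to finitely many equations between basis vectors.
\<close>
lemma module_hom_eq_on_span:
  assumes "module R M" "module R N"
    and f: "f \<in> module_hom R M N" and g: "g \<in> module_hom R M N"
    and S: "S \<subseteq> carrier M" and eq: "\<And>s. s \<in> S \<Longrightarrow> f s = g s"
    and v: "v \<in> module.span R M S"
  shows "f v = g v"
proof -
  interpret f: mod_hom R M N f using assms by (simp add: mod_hom_def mod_hom_axioms_def)
  interpret g: mod_hom R M N g using assms by (simp add: mod_hom_def mod_hom_axioms_def)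
  obtain a T where T: "finite T" "T \<subseteq> S" "a \<in> T \<rightarrow> carrier R" and v: "v = f.M.lincomb a T"
    using v unfolding f.M.span_def by blast
  have TM: "T \<subseteq> carrier M" using T S by blast
  have terms: "(\<lambda>s. a s \<odot>\<^bsub>M\<^esub> s) \<in> T \<rightarrow> carrier M" using T TM by (auto simp: Pi_iff subset_iff)
  have pt: "f (a s \<odot>\<^bsub>M\<^esub> s) = g (a s \<odot>\<^bsub>M\<^esub> s)" if "s \<in> T" for s
  proof -
    have "a s \<in> carrier R" "s \<in> carrier M" "s \<in> S" using that T TM by auto
    then show ?thesis by (simp add: eq)
  qed
  have "(\<Oplus>\<^bsub>N\<^esub>s\<in>T. f (a s \<odot>\<^bsub>M\<^esub> s)) = (\<Oplus>\<^bsub>N\<^esub>s\<in>T. g (a s \<odot>\<^bsub>M\<^esub> s))"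
    by (rule f.N.M.finsum_cong2) (use terms in \<open>auto simp: pt Pi_iff\<close>)
  then show ?thesis
    unfolding v f.M.lincomb_def f.hom_sum[OF TM terms] g.hom_sum[OF TM terms] .
qed

lemma bilinear_eq_on_span:
  assumes M: "module R M" and N: "module R N" and P: "module R P"
    and f: "bilinear_map R M N P f" and g: "bilinear_map R M N P g"
    and S: "S \<subseteq> carrier M" and T: "T \<subseteq> carrier N"
    and eq: "\<And>s t. s \<in> S \<Longrightarrow> t \<in> T \<Longrightarrow> f s t = g s t"
    and u: "u \<in> module.span R M S" and v: "v \<in> module.span R N T"
  shows "f u v = g u v"
proof -
  interpret M: module R M by fact
  have uM: "u \<in> carrier M" using M.span_is_subset2[OF S] u by blast
  have *: "f u t = g u t" if "t \<in> T" for t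
    by (rule module_hom_eq_on_span[OF M P _ _ S _ u, where f="\<lambda>u. f u t" and g="\<lambda>u. g u t"])
      (use f g T that eq in \<open>auto simp: bilinear_map_def\<close>)
  show ?thesis
    by (rule module_hom_eq_on_span[OF N P _ _ T _ v])
      (use f g uM * in \<open>auto simp: bilinear_map_def\<close>)
qed

lemma bilinear_mapI:
  assumes "\<And>a. a \<in> carrier A \<Longrightarrow> (\<lambda>b. f a b) \<in> module_hom R B P"
    and "\<And>b. b \<in> carrier B \<Longrightarrow> (\<lambda>a. f a b) \<in> module_hom R A P"
  shows "bilinear_map R A B P f"
  using assms by (simp add: bilinear_map_def)

lemma bilinear_homs:
  assumes "bilinear_map R A B P f"
  shows "a \<in> carrier A \<Longrightarrow> (\<lambda>b. f a b) \<in> module_hom R B P"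
    and "b \<in> carrier B \<Longrightarrow> (\<lambda>a. f a b) \<in> module_hom R A P"
  using assms by (simp_all add: bilinear_map_def)

lemma bilinear_compose:
  assumes f: "bilinear_map R C D P f" and g: "g \<in> module_hom R A C" and h: "h \<in> module_hom R B D"
  shows "bilinear_map R A B P (\<lambda>a b. f (g a) (h b))"
proof (rule bilinear_mapI)
  fix a assume "a \<in> carrier A"
  then show "(\<lambda>b. f (g a) (h b)) \<in> module_hom R B P"
    by (intro module_hom_compose[OF h] bilinear_homs(1)[OF f] module_hom_carrier[OF g])
next
  fix b assume "b \<in> carrier B"
  then show "(\<lambda>a. f (g a) (h b)) \<in> module_hom R A P"
    by (intro module_hom_compose[OF g] bilinear_homs(2)[OF f] module_hom_carrier[OF h])
qed

lemma module_hom_bilinear: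
  assumes f: "bilinear_map R A B C f" and g: "g \<in> module_hom R C P"
  shows "bilinear_map R A B P (\<lambda>a b. g (f a b))"
  by (intro bilinear_mapI module_hom_compose[OF _ g] bilinear_homs[OF f])

lemma bilinear_carrier:
  "bilinear_map R A B P f \<Longrightarrow> a \<in> carrier A \<Longrightarrow> b \<in> carrier B \<Longrightarrow> f a b \<in> carrier P"
  by (auto simp: bilinear_map_def module_hom_def)

lemma bilinear_zero:
  assumes "module R A" "module R B" "module R P" "bilinear_map R A B P f"
  shows "a \<in> carrier A \<Longrightarrow> f a \<zero>\<^bsub>B\<^esub> = \<zero>\<^bsub>P\<^esub>" "b \<in> carrier B \<Longrightarrow> f \<zero>\<^bsub>A\<^esub> b = \<zero>\<^bsub>P\<^esub>"
  using assms module_hom_zero[of R B P "\<lambda>b. f a b"] module_hom_zero[of R A P "\<lambda>a. f a b"]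
  by (auto simp: bilinear_map_def)

section \<open>Free modules and linear extension\<close>

lemma free_module_sel:
  assumes "ring K"
  shows "carrier (free_module K S) = {u \<in> S \<rightarrow>\<^sub>E carrier K. finite {s \<in> S. u s \<noteq> \<zero>\<^bsub>K\<^esub>}}"
    "\<zero>\<^bsub>free_module K S\<^esub> = (\<lambda>s\<in>S. \<zero>\<^bsub>K\<^esub>)"
    "u \<oplus>\<^bsub>free_module K S\<^esub> v = (\<lambda>s\<in>S. u s \<oplus>\<^bsub>K\<^esub> v s)"
    "r \<odot>\<^bsub>free_module K S\<^esub> u = (\<lambda>s\<in>S. r \<otimes>\<^bsub>K\<^esub> u s)"
  by (simp_all add: free_module_def ring.func_space_def[OF assms])

lemma free_module_is_module:
  assumes "cring K"
  shows "module K (free_module K S)"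
proof -
  interpret K: cring K by fact
  let ?supp = "\<lambda>u. {s \<in> S. u s \<noteq> \<zero>\<^bsub>K\<^esub>}"
  interpret F: module K "K.func_space S" by (rule K.func_space_is_module)
  have "submodule K {u \<in> S \<rightarrow>\<^sub>E carrier K. finite (?supp u)} (K.func_space S)"
  proof (rule submodule.intro, rule K.func_space_is_module, goal_cases)
    case 1 then show ?case by (auto simp: K.func_space_def)
  next
    case (2 u v)
    have "?supp (u \<oplus>\<^bsub>K.func_space S\<^esub> v) \<subseteq> ?supp u \<union> ?supp v"
      using 2 by (auto simp: K.func_space_def)
    then have "finite (?supp (u \<oplus>\<^bsub>K.func_space S\<^esub> v))" using 2 by (auto intro: finite_subset)
    then show ?case using 2 by (auto simp: K.func_space_def PiE_mem)
  next
    case 3 then show ?case by (auto simp: K.func_space_def)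
  next
    case (4 r u)
    have "?supp (r \<odot>\<^bsub>K.func_space S\<^esub> u) \<subseteq> ?supp u"
      using 4 by (auto simp: K.func_space_def)
    then have "finite (?supp (r \<odot>\<^bsub>K.func_space S\<^esub> u))" using 4 by (auto intro: finite_subset)
    then show ?case using 4 by (auto simp: K.func_space_def PiE_mem)
  qed
  from F.submodule_is_module[OF this] show ?thesis by (simp add: free_module_def)
qed

lemma free_gen_carrier:
  assumes "cring K" shows "free_gen K S s \<in> carrier (free_module K S)"
proof -
  interpret K: cring K by fact
  have "{t \<in> S. free_gen K S s t \<noteq> \<zero>\<^bsub>K\<^esub>} \<subseteq> {s}" by (auto simp: free_gen_def split: if_splits)
  then show ?thesis
    by (auto simp: free_module_sel[OF K.ring_axioms] free_gen_def intro: finite_subset)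
qed

text \<open>
  The sum has the shape that occurs inside \<^const>\<open>tensor_lift\<close>, restricted to the support of \<open>u\<close>
  because \<open>S\<close> itself may be infinite.
\<close>
definition free_ext ::
    "('k, 'm) ring_scheme \<Rightarrow> 's set \<Rightarrow> ('k, 'c, 'q) module_scheme \<Rightarrow> ('s \<Rightarrow> 'c) \<Rightarrow> ('s \<Rightarrow> 'k) \<Rightarrow> 'c"
  where "free_ext K S P f u = (\<Oplus>\<^bsub>P\<^esub>s \<in> {s \<in> S. u s \<noteq> \<zero>\<^bsub>K\<^esub>}. u s \<odot>\<^bsub>P\<^esub> f s)"

text \<open>
  Two formal sums generally have different supports.  This lemma allows them to be compared over a
  common finite index set; the extra summands have coefficient zero.
\<close>
lemma free_ext_superset:
  assumes "module K P" and f: "f \<in> S \<rightarrow> carrier P" and u: "u \<in> S \<rightarrow> carrier K"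
    and T: "finite T" "T \<subseteq> S" "{s \<in> S. u s \<noteq> \<zero>\<^bsub>K\<^esub>} \<subseteq> T"
  shows "free_ext K S P f u = (\<Oplus>\<^bsub>P\<^esub>s\<in>T. u s \<odot>\<^bsub>P\<^esub> f s)"
proof -
  interpret module K P by fact
  show ?thesis unfolding free_ext_def
    by (rule M.add.finprod_mono_neutral_cong_left) (use f u T in \<open>auto simp: Pi_iff subset_iff\<close>)
qed

lemma free_ext_hom:
  assumes P: "module K P" and f: "f \<in> S \<rightarrow> carrier P"
  shows "free_ext K S P f \<in> module_hom K (free_module K S) P"
proof -
  interpret P: module K P by fact
  note F = free_module_sel[OF P.R.ring_axioms]
  let ?supp = "\<lambda>u. {s \<in> S. u s \<noteq> \<zero>\<^bsub>K\<^esub>}"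
  show ?thesis
  proof (rule module_homI)
    fix u assume "u \<in> carrier (free_module K S)"
    then show "free_ext K S P f u \<in> carrier P"
      unfolding free_ext_def by (intro P.M.finsum_closed) (use f in \<open>auto simp: F Pi_iff\<close>)
  next
    fix u v assume u: "u \<in> carrier (free_module K S)" and v: "v \<in> carrier (free_module K S)"
    let ?T = "?supp u \<union> ?supp v"
    let ?w = "u \<oplus>\<^bsub>free_module K S\<^esub> v"
    have T: "finite ?T" "?T \<subseteq> S" using u v by (auto simp: F)
    have uv: "u \<in> S \<rightarrow> carrier K" "v \<in> S \<rightarrow> carrier K" using u v by (auto simp: F)
    have uvs: "u s \<in> carrier K" "v s \<in> carrier K" "f s \<in> carrier P" if "s \<in> S" for s
      using uv f that by auto
    have "free_ext K S P f ?w = (\<Oplus>\<^bsub>P\<^esub>s\<in>?T. ?w s \<odot>\<^bsub>P\<^esub> f s)"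
      by (rule free_ext_superset[OF P f _ T]) (use uvs in \<open>auto simp: F\<close>)
    also have "\<dots> = (\<Oplus>\<^bsub>P\<^esub>s\<in>?T. u s \<odot>\<^bsub>P\<^esub> f s \<oplus>\<^bsub>P\<^esub> v s \<odot>\<^bsub>P\<^esub> f s)"
      by (rule P.M.finsum_cong2) (use uvs in \<open>auto simp: F P.smult_l_distr\<close>)
    also have "\<dots> = (\<Oplus>\<^bsub>P\<^esub>s\<in>?T. u s \<odot>\<^bsub>P\<^esub> f s) \<oplus>\<^bsub>P\<^esub> (\<Oplus>\<^bsub>P\<^esub>s\<in>?T. v s \<odot>\<^bsub>P\<^esub> f s)"
      by (rule P.M.finsum_addf) (use uvs in auto)
    also have "\<dots> = free_ext K S P f u \<oplus>\<^bsub>P\<^esub> free_ext K S P f v"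
      using free_ext_superset[OF P f uv(1) T] free_ext_superset[OF P f uv(2) T] by simp
    finally show "free_ext K S P f ?w = free_ext K S P f u \<oplus>\<^bsub>P\<^esub> free_ext K S P f v" .
  next
    fix r u assume r: "r \<in> carrier K" and u: "u \<in> carrier (free_module K S)"
    let ?w = "r \<odot>\<^bsub>free_module K S\<^esub> u"
    have T: "finite (?supp u)" "?supp u \<subseteq> S" using u by (auto simp: F)
    have us: "u s \<in> carrier K" "f s \<in> carrier P" if "s \<in> S" for s
      using u f that by (auto simp: F)
    have "free_ext K S P f ?w = (\<Oplus>\<^bsub>P\<^esub>s\<in>?supp u. ?w s \<odot>\<^bsub>P\<^esub> f s)"
      by (rule free_ext_superset[OF P f _ T]) (use us r in \<open>auto simp: F\<close>)
    also have "\<dots> = (\<Oplus>\<^bsub>P\<^esub>s\<in>?supp u. r \<odot>\<^bsub>P\<^esub> (u s \<odot>\<^bsub>P\<^esub> f s))"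
      by (rule P.M.finsum_cong2) (use us r in \<open>auto simp: F P.smult_assoc1\<close>)
    also have "\<dots> = r \<odot>\<^bsub>P\<^esub> free_ext K S P f u"
      unfolding free_ext_def by (rule P.finsum_smult[symmetric]) (use us r in auto)
    finally show "free_ext K S P f ?w = r \<odot>\<^bsub>P\<^esub> free_ext K S P f u" .
  qed
qed

lemma free_ext_gen:
  assumes P: "module K P" and f: "f \<in> S \<rightarrow> carrier P" and s: "s \<in> S"
  shows "free_ext K S P f (free_gen K S s) = f s"
proof -
  interpret P: module K P by fact
  have "free_ext K S P f (free_gen K S s) = (\<Oplus>\<^bsub>P\<^esub>t\<in>{s}. free_gen K S s t \<odot>\<^bsub>P\<^esub> f t)"
    by (rule free_ext_superset[OF P f]) (use s in \<open>auto simp: free_gen_def split: if_splits\<close>)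
  also have "\<dots> = f s" using s f by (auto simp: free_gen_def Pi_iff)
  finally show ?thesis .
qed

section \<open>Quotient modules\<close>

context
  fixes R :: "('k, 'm) ring_scheme" and M :: "('k, 'a, 'n) module_scheme" and N
  assumes N: "submodule R N M"
begin

interpretation M: module R M using N by (rule submodule.module)

lemma submodule_abelian_subgroup: "abelian_subgroup N M"
proof (rule abelian_subgroupI3)
  interpret submodule R N M by (rule N)
  show "additive_subgroup N M"
  proof (rule additive_subgroupI, rule M.add.subgroupI)
    show "N \<subseteq> carrier M" by (rule subset)
    show "N \<noteq> {}" using zero_closed by blast
    show "a \<oplus>\<^bsub>M\<^esub> b \<in> N" if "a \<in> N" "b \<in> N" for a b using that by (rule m_closed)
    fix a assume a: "a \<in> N"
    have "\<ominus>\<^bsub>M\<^esub> a = (\<ominus>\<^bsub>R\<^esub> \<one>\<^bsub>R\<^esub>) \<odot>\<^bsub>M\<^esub> a" using a subset by (subst M.smult_minus_1) auto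
    also have "\<dots> \<in> N" using a by auto
    finally show "\<ominus>\<^bsub>M\<^esub> a \<in> N" .
  qed
qed (rule M.M.abelian_group_axioms)

interpretation N: abelian_subgroup N M by (rule submodule_abelian_subgroup)

lemma quotient_module_sel:
  "carrier (quotient_module M N) = (\<lambda>v. N +>\<^bsub>M\<^esub> v) ` carrier M"
  "\<zero>\<^bsub>quotient_module M N\<^esub> = N +>\<^bsub>M\<^esub> \<zero>\<^bsub>M\<^esub>"
  by (auto simp: quotient_module_def A_RCOSETS_def' N.a_subset)

lemma coset_add:
  "u \<in> carrier M \<Longrightarrow> v \<in> carrier M \<Longrightarrow>
    (N +>\<^bsub>M\<^esub> u) \<oplus>\<^bsub>quotient_module M N\<^esub> (N +>\<^bsub>M\<^esub> v) = N +>\<^bsub>M\<^esub> (u \<oplus>\<^bsub>M\<^esub> v)"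
  by (simp add: quotient_module_def N.a_rcos_sum)

text \<open>
  The scalar multiple of a coset is the union of the cosets of the multiples of its elements.  All of
  these coincide, since two elements of the coset differ by some \<open>n\<close> in the submodule, and then
  their multiples differ by \<open>r \<odot> n\<close>, which is again in the submodule.
\<close>
lemma coset_smult:
  assumes r: "r \<in> carrier R" and u: "u \<in> carrier M"
  shows "r \<odot>\<^bsub>quotient_module M N\<^esub> (N +>\<^bsub>M\<^esub> u) = N +>\<^bsub>M\<^esub> (r \<odot>\<^bsub>M\<^esub> u)"
proof -
  have "N +>\<^bsub>M\<^esub> (r \<odot>\<^bsub>M\<^esub> v) = N +>\<^bsub>M\<^esub> (r \<odot>\<^bsub>M\<^esub> u)" if v: "v \<in> N +>\<^bsub>M\<^esub> u" for v
  proof -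
    obtain n where n: "n \<in> N" "v = n \<oplus>\<^bsub>M\<^esub> u" using v by (auto simp: a_r_coset_def')
    have nM: "n \<in> carrier M" using n N.a_subset by blast
    have rn: "r \<odot>\<^bsub>M\<^esub> n \<in> N" using N r n by (auto simp: submodule.smult_closed)
    have "N +>\<^bsub>M\<^esub> (r \<odot>\<^bsub>M\<^esub> v) = (N +>\<^bsub>M\<^esub> (r \<odot>\<^bsub>M\<^esub> n)) +>\<^bsub>M\<^esub> (r \<odot>\<^bsub>M\<^esub> u)"
      using n nM r u by (simp add: M.smult_r_distr M.a_coset_add_assoc N.a_subset)
    then show ?thesis using N.a_rcos_const[OF rn] by simp
  qed
  moreover have "u \<in> N +>\<^bsub>M\<^esub> u" by (rule N.a_rcos_self[OF u])
  ultimately have "(\<Union>v\<in>N +>\<^bsub>M\<^esub> u. N +>\<^bsub>M\<^esub> (r \<odot>\<^bsub>M\<^esub> v)) = N +>\<^bsub>M\<^esub> (r \<odot>\<^bsub>M\<^esub> u)"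
    by blast
  then show ?thesis by (simp add: quotient_module_def)
qed

lemma quotient_module_is_module: "module R (quotient_module M N)"
proof (rule module_criteria, rule M.R.cring_axioms, goal_cases)
  case 3
  have "(N +>\<^bsub>M\<^esub> v) \<oplus>\<^bsub>quotient_module M N\<^esub> (N +>\<^bsub>M\<^esub> (\<ominus>\<^bsub>M\<^esub> v)) = \<zero>\<^bsub>quotient_module M N\<^esub>"
    if "v \<in> carrier M" for v
    using that by (simp add: coset_add quotient_module_sel(2) M.r_neg)
  then show ?case unfolding quotient_module_sel(1) by blast
next
  case 5 then show ?case by (auto simp: quotient_module_sel coset_add M.M.a_comm)
next
  case 6 then show ?case by (auto simp: quotient_module_sel coset_add M.M.a_assoc)
next
  case 8 then show ?case by (auto simp: quotient_module_sel coset_smult M.smult_assoc1)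
next
  case 10
  have "(a \<oplus>\<^bsub>R\<^esub> b) \<odot>\<^bsub>quotient_module M N\<^esub> (N +>\<^bsub>M\<^esub> v)
      = a \<odot>\<^bsub>quotient_module M N\<^esub> (N +>\<^bsub>M\<^esub> v) \<oplus>\<^bsub>quotient_module M N\<^esub> b \<odot>\<^bsub>quotient_module M N\<^esub> (N +>\<^bsub>M\<^esub> v)"
    if "a \<in> carrier R" "b \<in> carrier R" "v \<in> carrier M" for a b v
    using that by (simp add: coset_add coset_smult M.smult_l_distr)
  then show ?case unfolding quotient_module_sel(1) by blast
qed (auto simp: quotient_module_sel coset_add coset_smult M.smult_r_distr)

lemma coset_hom: "(\<lambda>v. N +>\<^bsub>M\<^esub> v) \<in> module_hom R M (quotient_module M N)"
  by (rule module_homI) (simp_all add: quotient_module_sel(1) coset_add coset_smult)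

lemma coset_eqI:
  assumes "u \<in> carrier M" "v \<in> carrier M" "u \<ominus>\<^bsub>M\<^esub> v \<in> N"
  shows "N +>\<^bsub>M\<^esub> u = N +>\<^bsub>M\<^esub> v"
proof (rule M.a_coset_add_inv1)
  show "N +>\<^bsub>M\<^esub> (u \<oplus>\<^bsub>M\<^esub> (\<ominus>\<^bsub>M\<^esub> v)) = N"
    using assms(3) unfolding a_minus_def by (rule N.a_rcos_const)
qed (rule assms(1), rule assms(2), rule N.a_subset)

end

section \<open>The universal property of the tensor product\<close>

text \<open>
  Both directions are needed: the relators lie in the kernel, which gives the bilinearity of the pure
  tensor, and a submodule containing them contains the kernel, which gives well-definedness of maps
  out of the tensor product.
\<close>
lemma tensor_relators_subset_iff:
  "tensor_relators K A B \<subseteq> X \<longleftrightarrow>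
    (let F = tensor_free K A B; g = (\<lambda>a b. free_gen K (carrier A \<times> carrier B) (a, b)) in
      (((\<forall>a\<in>carrier A. \<forall>a'\<in>carrier A. \<forall>b\<in>carrier B.
        g (a \<oplus>\<^bsub>A\<^esub> a') b \<ominus>\<^bsub>F\<^esub> (g a b \<oplus>\<^bsub>F\<^esub> g a' b) \<in> X) \<and>
      (\<forall>a\<in>carrier A. \<forall>b\<in>carrier B. \<forall>b'\<in>carrier B.
        g a (b \<oplus>\<^bsub>B\<^esub> b') \<ominus>\<^bsub>F\<^esub> (g a b \<oplus>\<^bsub>F\<^esub> g a b') \<in> X)) \<and>
      (\<forall>r\<in>carrier K. \<forall>a\<in>carrier A. \<forall>b\<in>carrier B.
        g (r \<odot>\<^bsub>A\<^esub> a) b \<ominus>\<^bsub>F\<^esub> (r \<odot>\<^bsub>F\<^esub> g a b) \<in> X)) \<and>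
      (\<forall>r\<in>carrier K. \<forall>a\<in>carrier A. \<forall>b\<in>carrier B.
        g a (r \<odot>\<^bsub>B\<^esub> b) \<ominus>\<^bsub>F\<^esub> (r \<odot>\<^bsub>F\<^esub> g a b) \<in> X))"
  unfolding tensor_relators_def Let_def Un_subset_iff
  by (intro arg_cong2[where f = "(\<and>)"]; blast)

locale tensor_product = A: module K A + B: module K B
  for K :: "('k, 'm) ring_scheme" and A :: "('k, 'a, 'n) module_scheme"
    and B :: "('k, 'b, 'p) module_scheme"
begin

abbreviation "F \<equiv> tensor_free K A B"
abbreviation "N \<equiv> tensor_kernel K A B"
abbreviation "gen a b \<equiv> free_gen K (carrier A \<times> carrier B) (a, b)"
abbreviation "ext P f \<equiv> free_ext K (carrier A \<times> carrier B) P (\<lambda>s. f (fst s) (snd s))"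

sublocale F: module K F
  unfolding tensor_free_def by (rule free_module_is_module) (rule A.R.cring_axioms)

lemma gen_carrier [simp]: "gen a b \<in> carrier F"
  unfolding tensor_free_def by (rule free_gen_carrier) (rule A.R.cring_axioms)

lemma relators_subset: "tensor_relators K A B \<subseteq> carrier F"
  unfolding tensor_relators_subset_iff Let_def by simp

lemma kernel_submodule: "submodule K N F"
  unfolding tensor_kernel_def by (rule F.span_is_submodule[OF relators_subset])

lemma tensor_module: "module K (tensor K A B)"
  unfolding tensor_def by (rule quotient_module_is_module[OF kernel_submodule])

sublocale T: module K "tensor K A B"
  by (rule tensor_module)

lemma tensor_cases:
  assumes "t \<in> carrier (tensor K A B)"
  obtains u where "u \<in> carrier F" "t = N +>\<^bsub>F\<^esub> u"
  using assms unfolding tensor_def quotient_module_sel[OF kernel_submodule] by blast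

lemma coset_hom_tensor: "(\<lambda>u. N +>\<^bsub>F\<^esub> u) \<in> module_hom K F (tensor K A B)"
  unfolding tensor_def by (rule coset_hom[OF kernel_submodule])

text \<open>
  Each relator is a difference of the two formal sums whose cosets are compared.
\<close>
lemma relator_cosets:
  assumes a: "a \<in> carrier A" and b: "b \<in> carrier B"
  shows "a' \<in> carrier A \<Longrightarrow> N +>\<^bsub>F\<^esub> gen (a \<oplus>\<^bsub>A\<^esub> a') b = N +>\<^bsub>F\<^esub> (gen a b \<oplus>\<^bsub>F\<^esub> gen a' b)"
    and "b' \<in> carrier B \<Longrightarrow> N +>\<^bsub>F\<^esub> gen a (b \<oplus>\<^bsub>B\<^esub> b') = N +>\<^bsub>F\<^esub> (gen a b \<oplus>\<^bsub>F\<^esub> gen a b')"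
    and "r \<in> carrier K \<Longrightarrow> N +>\<^bsub>F\<^esub> gen (r \<odot>\<^bsub>A\<^esub> a) b = N +>\<^bsub>F\<^esub> (r \<odot>\<^bsub>F\<^esub> gen a b)"
    and "r \<in> carrier K \<Longrightarrow> N +>\<^bsub>F\<^esub> gen a (r \<odot>\<^bsub>B\<^esub> b) = N +>\<^bsub>F\<^esub> (r \<odot>\<^bsub>F\<^esub> gen a b)"
proof -
  have "tensor_relators K A B \<subseteq> N"
    unfolding tensor_kernel_def by (rule F.in_own_span[OF relators_subset])
  note rel = this[unfolded tensor_relators_subset_iff Let_def]
  note eq = coset_eqI[OF kernel_submodule]
  show "N +>\<^bsub>F\<^esub> gen (a \<oplus>\<^bsub>A\<^esub> a') b = N +>\<^bsub>F\<^esub> (gen a b \<oplus>\<^bsub>F\<^esub> gen a' b)" if "a' \<in> carrier A"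
    by (rule eq) (use rel a b that in simp_all)
  show "N +>\<^bsub>F\<^esub> gen a (b \<oplus>\<^bsub>B\<^esub> b') = N +>\<^bsub>F\<^esub> (gen a b \<oplus>\<^bsub>F\<^esub> gen a b')" if "b' \<in> carrier B"
    by (rule eq) (use rel a b that in simp_all)
  assume r: "r \<in> carrier K"
  show "N +>\<^bsub>F\<^esub> gen (r \<odot>\<^bsub>A\<^esub> a) b = N +>\<^bsub>F\<^esub> (r \<odot>\<^bsub>F\<^esub> gen a b)"
    by (rule eq) (use rel a b r in simp_all)
  show "N +>\<^bsub>F\<^esub> gen a (r \<odot>\<^bsub>B\<^esub> b) = N +>\<^bsub>F\<^esub> (r \<odot>\<^bsub>F\<^esub> gen a b)"
    by (rule eq) (use rel a b r in simp_all)
qed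

lemma pure_tensor_bilinear: "bilinear_map K A B (tensor K A B) (pure_tensor K A B)"
  unfolding pure_tensor_def
  by (intro bilinear_mapI module_homI)
    (simp_all add: relator_cosets module_hom_carrier[OF coset_hom_tensor]
      module_hom_add[OF coset_hom_tensor] module_hom_smult[OF coset_hom_tensor])

lemma pure_tensor_carrier [simp]:
  "a \<in> carrier A \<Longrightarrow> b \<in> carrier B \<Longrightarrow> pure_tensor K A B a b \<in> carrier (tensor K A B)"
  by (rule bilinear_carrier[OF pure_tensor_bilinear])

context
  fixes P :: "('k, 'c, 'q) module_scheme" and f
  assumes P: "module K P" and f: "bilinear_map K A B P f"
begin

interpretation P: module K P by (rule P)

lemma bilinear_map_on_pairs: "(\<lambda>s. f (fst s) (snd s)) \<in> carrier A \<times> carrier B \<rightarrow> carrier P"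
  using bilinear_carrier[OF f] by auto

lemma ext_hom: "ext P f \<in> module_hom K F P"
  unfolding tensor_free_def by (rule free_ext_hom[OF P bilinear_map_on_pairs])

lemma ext_gen: "a \<in> carrier A \<Longrightarrow> b \<in> carrier B \<Longrightarrow> ext P f (gen a b) = f a b"
  using free_ext_gen[OF P bilinear_map_on_pairs, of "(a, b)"] by simp

text \<open>
  The linear extension of a bilinear map sends every relator to zero, by bilinearity.  Its kernel is
  a submodule and therefore contains their span.
\<close>
lemma ext_kernel: "n \<in> N \<Longrightarrow> ext P f n = \<zero>\<^bsub>P\<^esub>"
proof -
  interpret E: mod_hom K F P "ext P f"
    using ext_hom F.module_axioms P by (simp add: mod_hom_def mod_hom_axioms_def)
  note fh = bilinear_homs[OF f]
  have "tensor_relators K A B \<subseteq> E.ker"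
    unfolding tensor_relators_subset_iff Let_def E.ker_def
    by (simp add: ext_gen bilinear_carrier[OF f] module_hom_add[OF fh(1)]
        module_hom_add[OF fh(2)] module_hom_smult[OF fh(1)] module_hom_smult[OF fh(2)])
  then have "N \<subseteq> E.ker"
    unfolding tensor_kernel_def by (rule F.span_is_subset[OF _ E.ker_is_submodule])
  then show "n \<in> N \<Longrightarrow> ext P f n = \<zero>\<^bsub>P\<^esub>" by (auto simp: E.ker_def)
qed

text \<open>
  By the preceding lemma the extension is constant on cosets.  So the set in the
  definition of \<^const>\<open>tensor_lift\<close> is a singleton, and the lift can be computed from any representative.
\<close>
lemma tensor_lift_coset:
  assumes u: "u \<in> carrier F"
  shows "tensor_lift K A B P f (N +>\<^bsub>F\<^esub> u) = ext P f u"
proof -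
  interpret N: submodule K N F by (rule kernel_submodule)
  have "ext P f (n \<oplus>\<^bsub>F\<^esub> u) = ext P f u" if n: "n \<in> N" for n
  proof -
    have "n \<in> carrier F" using n N.subset by blast
    then show ?thesis
      using module_hom_carrier[OF ext_hom u] u
      by (simp add: module_hom_add[OF ext_hom] ext_kernel[OF n])
  qed
  then have "ext P f ` (N +>\<^bsub>F\<^esub> u) = (\<lambda>n. ext P f u) ` N"
    by (auto simp: a_r_coset_def' image_iff)
  also have "\<dots> = {ext P f u}" using N.zero_closed by blast
  finally show ?thesis unfolding tensor_lift_def free_ext_def by simp
qed

lemma tensor_lift_hom: "tensor_lift K A B P f \<in> module_hom K (tensor K A B) P"
proof (rule module_homI)
  note smult = module_hom_smult[OF coset_hom_tensor]
  fix s assume "s \<in> carrier (tensor K A B)"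
  then obtain u where u: "u \<in> carrier F" "s = N +>\<^bsub>F\<^esub> u" by (rule tensor_cases)
  then show "tensor_lift K A B P f s \<in> carrier P"
    by (simp add: tensor_lift_coset module_hom_carrier[OF ext_hom])
  fix r assume r: "r \<in> carrier K"
  then show "tensor_lift K A B P f (r \<odot>\<^bsub>tensor K A B\<^esub> s) = r \<odot>\<^bsub>P\<^esub> tensor_lift K A B P f s"
    using u by (simp add: tensor_lift_coset smult[symmetric] module_hom_smult[OF ext_hom])
next
  note add = module_hom_add[OF coset_hom_tensor]
  fix s t assume "s \<in> carrier (tensor K A B)" "t \<in> carrier (tensor K A B)"
  then obtain u v where "u \<in> carrier F" "s = N +>\<^bsub>F\<^esub> u" "v \<in> carrier F" "t = N +>\<^bsub>F\<^esub> v"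
    by (metis tensor_cases)
  then show "tensor_lift K A B P f (s \<oplus>\<^bsub>tensor K A B\<^esub> t)
      = tensor_lift K A B P f s \<oplus>\<^bsub>P\<^esub> tensor_lift K A B P f t"
    by (simp add: tensor_lift_coset add[symmetric] module_hom_add[OF ext_hom])
qed

lemma tensor_lift_pure:
  "a \<in> carrier A \<Longrightarrow> b \<in> carrier B \<Longrightarrow> tensor_lift K A B P f (pure_tensor K A B a b) = f a b"
  unfolding pure_tensor_def by (simp add: tensor_lift_coset ext_gen)

end

text \<open>
  The lift depends linearly on the bilinear map that is lifted: for a fixed representative of \<open>t\<close> it is
  a finite sum of multiples of values \<open>f d a b\<close>.  This handles the nested lifts in the definitions of the
  associator and of the product on \<open>A \<otimes> A\<close>, where the inner lift has the variables of the outer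
  one as parameters.
\<close>
lemma tensor_lift_param_hom:
  assumes P: "module K P"
    and f: "\<And>d. d \<in> carrier D \<Longrightarrow> bilinear_map K A B P (f d)"
    and fd: "\<And>a b. a \<in> carrier A \<Longrightarrow> b \<in> carrier B \<Longrightarrow> (\<lambda>d. f d a b) \<in> module_hom K D P"
    and D: "module K D"
    and t: "t \<in> carrier (tensor K A B)"
  shows "(\<lambda>d. tensor_lift K A B P (f d) t) \<in> module_hom K D P"
proof -
  interpret P: module K P by (rule P)
  interpret D: module K D by (rule D)
  obtain u where u: "u \<in> carrier F" "t = N +>\<^bsub>F\<^esub> u" using t by (rule tensor_cases)
  let ?S = "{s \<in> carrier A \<times> carrier B. u s \<noteq> \<zero>\<^bsub>K\<^esub>}"
  have u_carrier: "u s \<in> carrier K" if "s \<in> ?S" for s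
    using u(1) that by (auto simp: tensor_free_def free_module_sel[OF A.R.ring_axioms])
  have fd': "(\<lambda>d. f d (fst s) (snd s)) \<in> module_hom K D P" if "s \<in> ?S" for s
    using that by (intro fd) auto
  note [simp] = module_hom_carrier[OF fd'] module_hom_add[OF fd'] module_hom_smult[OF fd']
  have lift: "tensor_lift K A B P (f d) t = (\<Oplus>\<^bsub>P\<^esub>s\<in>?S. u s \<odot>\<^bsub>P\<^esub> f d (fst s) (snd s))"
    if "d \<in> carrier D" for d
    using tensor_lift_coset[OF P f[OF that] u(1)] u(2) by (simp add: free_ext_def)
  show ?thesis
  proof (rule module_homI)
    fix d assume d: "d \<in> carrier D"
    show "tensor_lift K A B P (f d) t \<in> carrier P"
      by (rule module_hom_carrier[OF tensor_lift_hom[OF P f[OF d]] t])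
    fix r assume r: "r \<in> carrier K"
    have "(\<Oplus>\<^bsub>P\<^esub>s\<in>?S. u s \<odot>\<^bsub>P\<^esub> f (r \<odot>\<^bsub>D\<^esub> d) (fst s) (snd s))
        = (\<Oplus>\<^bsub>P\<^esub>s\<in>?S. r \<odot>\<^bsub>P\<^esub> (u s \<odot>\<^bsub>P\<^esub> f d (fst s) (snd s)))"
      by (rule P.M.finsum_cong2)
        (use d r u_carrier in \<open>auto simp: P.smult_assoc_simp A.R.m_comm\<close>)
    also have "\<dots> = r \<odot>\<^bsub>P\<^esub> (\<Oplus>\<^bsub>P\<^esub>s\<in>?S. u s \<odot>\<^bsub>P\<^esub> f d (fst s) (snd s))"
      by (rule P.finsum_smult[symmetric]) (use d r u_carrier in auto)
    finally show "tensor_lift K A B P (f (r \<odot>\<^bsub>D\<^esub> d)) t = r \<odot>\<^bsub>P\<^esub> tensor_lift K A B P (f d) t"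
      using d r by (simp add: lift)
  next
    fix d e assume d: "d \<in> carrier D" and e: "e \<in> carrier D"
    have "(\<Oplus>\<^bsub>P\<^esub>s\<in>?S. u s \<odot>\<^bsub>P\<^esub> f (d \<oplus>\<^bsub>D\<^esub> e) (fst s) (snd s))
        = (\<Oplus>\<^bsub>P\<^esub>s\<in>?S. u s \<odot>\<^bsub>P\<^esub> f d (fst s) (snd s) \<oplus>\<^bsub>P\<^esub> u s \<odot>\<^bsub>P\<^esub> f e (fst s) (snd s))"
      by (rule P.M.finsum_cong2) (use d e u_carrier in \<open>auto simp: P.smult_r_distr\<close>)
    also have "\<dots> = (\<Oplus>\<^bsub>P\<^esub>s\<in>?S. u s \<odot>\<^bsub>P\<^esub> f d (fst s) (snd s))
        \<oplus>\<^bsub>P\<^esub> (\<Oplus>\<^bsub>P\<^esub>s\<in>?S. u s \<odot>\<^bsub>P\<^esub> f e (fst s) (snd s))"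
      by (rule P.M.finsum_addf) (use d e u_carrier in auto)
    finally show "tensor_lift K A B P (f (d \<oplus>\<^bsub>D\<^esub> e)) t
        = tensor_lift K A B P (f d) t \<oplus>\<^bsub>P\<^esub> tensor_lift K A B P (f e) t"
      using d e by (simp add: lift)
  qed
qed

end

section \<open>Maps between tensor products\<close>

lemma tensor_module: "module K A \<Longrightarrow> module K B \<Longrightarrow> module K (tensor K A B)"
  by (rule tensor_product.tensor_module) (rule tensor_product.intro)

lemma tensor_map_hom_pure:
  assumes A: "module K A" and B: "module K B" and C: "module K C" and D: "module K D"
    and f: "f \<in> module_hom K A C" and g: "g \<in> module_hom K B D"
  shows tensor_map_hom: "tensor_map K A B C D f g \<in> module_hom K (tensor K A B) (tensor K C D)"
    and tensor_map_pure: "a \<in> carrier A \<Longrightarrow> b \<in> carrier B \<Longrightarrow>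
      tensor_map K A B C D f g (pure_tensor K A B a b) = pure_tensor K C D (f a) (g b)"
proof -
  interpret AB: tensor_product K A B using A B by (rule tensor_product.intro)
  interpret CD: tensor_product K C D using C D by (rule tensor_product.intro)
  note bil = bilinear_compose[OF CD.pure_tensor_bilinear f g]
  show "tensor_map K A B C D f g \<in> module_hom K (tensor K A B) (tensor K C D)"
    unfolding tensor_map_def by (rule AB.tensor_lift_hom[OF CD.tensor_module bil])
  show "a \<in> carrier A \<Longrightarrow> b \<in> carrier B \<Longrightarrow>
      tensor_map K A B C D f g (pure_tensor K A B a b) = pure_tensor K C D (f a) (g b)"
    unfolding tensor_map_def by (rule AB.tensor_lift_pure[OF CD.tensor_module bil])
qed

lemma tensor_assoc_hom_pure:
  assumes A: "module K A" and B: "module K B" and C: "module K C"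
  shows tensor_assoc_hom: "tensor_assoc K A B C
      \<in> module_hom K (tensor K (tensor K A B) C) (tensor K A (tensor K B C))"
    and tensor_assoc_pure: "a \<in> carrier A \<Longrightarrow> b \<in> carrier B \<Longrightarrow> c \<in> carrier C \<Longrightarrow>
      tensor_assoc K A B C (pure_tensor K (tensor K A B) C (pure_tensor K A B a b) c)
      = pure_tensor K A (tensor K B C) a (pure_tensor K B C b c)"
proof -
  interpret AB: tensor_product K A B using A B by (rule tensor_product.intro)
  interpret BC: tensor_product K B C using B C by (rule tensor_product.intro)
  interpret AB_C: tensor_product K "tensor K A B" C
    using AB.tensor_module C by (rule tensor_product.intro)
  interpret A_BC: tensor_product K A "tensor K B C"
    using A BC.tensor_module by (rule tensor_product.intro)
  let ?P = "tensor K A (tensor K B C)"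
  let ?g = "\<lambda>c a b. pure_tensor K A (tensor K B C) a (pure_tensor K B C b c)"
  have g: "bilinear_map K A B ?P (?g c)" if "c \<in> carrier C" for c
    using bilinear_compose[OF A_BC.pure_tensor_bilinear module_hom_id
        bilinear_homs(2)[OF BC.pure_tensor_bilinear that]] by simp
  have g_param: "(\<lambda>c. ?g c a b) \<in> module_hom K C ?P" if "a \<in> carrier A" "b \<in> carrier B" for a b
    using module_hom_compose[OF bilinear_homs(1)[OF BC.pure_tensor_bilinear that(2)]
        bilinear_homs(1)[OF A_BC.pure_tensor_bilinear that(1)]] .
  have bil: "bilinear_map K (tensor K A B) C ?P (\<lambda>t c. tensor_lift K A B ?P (?g c) t)"
    by (intro bilinear_mapI AB.tensor_lift_hom AB.tensor_lift_param_hom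
        A_BC.tensor_module g g_param C)
  show "tensor_assoc K A B C \<in> module_hom K (tensor K (tensor K A B) C) ?P"
    unfolding tensor_assoc_def Let_def by (rule AB_C.tensor_lift_hom[OF A_BC.tensor_module bil])
  assume "a \<in> carrier A" "b \<in> carrier B" "c \<in> carrier C"
  then show "tensor_assoc K A B C (pure_tensor K (tensor K A B) C (pure_tensor K A B a b) c)
      = pure_tensor K A (tensor K B C) a (pure_tensor K B C b c)"
    unfolding tensor_assoc_def Let_def
    by (simp add: AB_C.tensor_lift_pure[OF A_BC.tensor_module bil]
        AB.tensor_lift_pure[OF A_BC.tensor_module g])
qed

lemma tensor_mult_bilinear_pure:
  assumes A: "module K A" and \<mu>: "bilinear_map K A A A \<mu>"
  shows tensor_mult_bilinear:
      "bilinear_map K (tensor K A A) (tensor K A A) (tensor K A A) (tensor_mult K A \<mu>)"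
    and tensor_mult_pure: "\<lbrakk>a \<in> carrier A; b \<in> carrier A; a' \<in> carrier A; b' \<in> carrier A\<rbrakk> \<Longrightarrow>
      tensor_mult K A \<mu> (pure_tensor K A A a b) (pure_tensor K A A a' b')
      = pure_tensor K A A (\<mu> a a') (\<mu> b b')"
proof -
  interpret AA: tensor_product K A A using A A by (rule tensor_product.intro)
  let ?T = "tensor K A A"
  let ?g = "\<lambda>a b a' b'. pure_tensor K A A (\<mu> a a') (\<mu> b b')"
  have g: "bilinear_map K A A ?T (?g a b)" if "a \<in> carrier A" "b \<in> carrier A" for a b
    by (rule bilinear_compose[OF AA.pure_tensor_bilinear])
      (use that in \<open>auto intro: bilinear_homs[OF \<mu>]\<close>)
  have g': "bilinear_map K A A ?T (\<lambda>a b. ?g a b a' b')" if "a' \<in> carrier A" "b' \<in> carrier A" for a' b'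
    by (rule bilinear_compose[OF AA.pure_tensor_bilinear])
      (use that in \<open>auto intro: bilinear_homs[OF \<mu>]\<close>)
  have outer: "bilinear_map K A A ?T (\<lambda>a b. tensor_lift K A A ?T (?g a b) t)"
    if t: "t \<in> carrier ?T" for t
    by (intro bilinear_mapI AA.tensor_lift_param_hom t AA.tensor_module A g)
      (auto intro: bilinear_homs[OF g'])
  show "bilinear_map K ?T ?T ?T (tensor_mult K A \<mu>)"
    unfolding tensor_mult_def
  proof (rule bilinear_mapI)
    fix s assume s: "s \<in> carrier ?T"
    show "(\<lambda>t. tensor_lift K A A ?T (\<lambda>a b. tensor_lift K A A ?T (?g a b) t) s) \<in> module_hom K ?T ?T"
      by (intro AA.tensor_lift_param_hom outer s AA.tensor_module AA.tensor_lift_hom g)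
  next
    fix t assume t: "t \<in> carrier ?T"
    show "(\<lambda>s. tensor_lift K A A ?T (\<lambda>a b. tensor_lift K A A ?T (?g a b) t) s) \<in> module_hom K ?T ?T"
      by (intro AA.tensor_lift_hom AA.tensor_module outer t)
  qed
  assume "a \<in> carrier A" "b \<in> carrier A" "a' \<in> carrier A" "b' \<in> carrier A"
  then show "tensor_mult K A \<mu> (pure_tensor K A A a b) (pure_tensor K A A a' b') = ?g a b a' b'"
    unfolding tensor_mult_def
    by (simp add: AA.tensor_lift_pure[OF AA.tensor_module outer]
        AA.tensor_lift_pure[OF AA.tensor_module g])
qed

section \<open>Counits and self-distributivity\<close>

lemma scalar_module_is_module:
  assumes "cring K" shows "module K (scalar_module K)"
proof -
  interpret cring K by fact
  show ?thesis
    by (rule module_criteria) (auto simp: scalar_module_def a_ac m_assoc l_distr r_distr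
        cring_axioms intro!: bexI[of _ "\<ominus>\<^bsub>K\<^esub> _"] r_neg)
qed

text \<open>
  A counit \<open>\<epsilon>\<close> recovers \<open>x\<close> from \<open>\<Delta> x\<close> by the linear map \<open>\<epsilon> \<otimes> id\<close> followed by
  \<open>K \<otimes> A \<cong> A\<close>.  So a comultiplication with a counit is injective.
\<close>
lemma not_counital_if_comult_kernel:
  assumes A: "module K A" and x: "x \<in> carrier A" "x \<noteq> \<zero>\<^bsub>A\<^esub>" and \<Delta>: "\<Delta> x = \<zero>\<^bsub>tensor K A A\<^esub>"
  shows "\<not> counital K A \<Delta>"
proof
  assume "counital K A \<Delta>"
  then obtain \<epsilon> where \<epsilon>: "\<epsilon> \<in> module_hom K A (scalar_module K)"
    and counit: "tensor_lunit K A (tensor_map K A A (scalar_module K) A \<epsilon> id (\<Delta> x)) = x"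
    using x(1) unfolding counital_def is_counit_def by blast
  interpret A: module K A by (rule A)
  have S: "module K (scalar_module K)" by (rule scalar_module_is_module) (rule A.R.cring_axioms)
  interpret SA: tensor_product K "scalar_module K" A using S A by (rule tensor_product.intro)
  have smult: "bilinear_map K (scalar_module K) A A (\<lambda>r a. r \<odot>\<^bsub>A\<^esub> a)"
    by (intro bilinear_mapI module_homI)
      (auto simp: scalar_module_def A.smult_l_distr A.smult_r_distr A.smult_assoc_simp A.R.m_comm)
  have "tensor_map K A A (scalar_module K) A \<epsilon> id (\<Delta> x) = \<zero>\<^bsub>tensor K (scalar_module K) A\<^esub>"
    unfolding \<Delta> by (rule module_hom_zero[OF tensor_module[OF A A] SA.tensor_module
          tensor_map_hom[OF A A S A \<epsilon> module_hom_id]])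
  then have "x = \<zero>\<^bsub>A\<^esub>"
    using counit module_hom_zero[OF SA.tensor_module A SA.tensor_lift_hom[OF A smult]]
    by (simp add: tensor_lunit_def)
  with x(2) show False ..
qed

text \<open>
  Coassociativity is automatic: both iterated comultiplications kill \<open>x\<close> and send \<open>y\<close> to
  \<open>y \<otimes> y \<otimes> y\<close>.  In the law of self-distributivity
  the third argument may be taken to be \<open>x\<close> or \<open>y\<close>.  For \<open>x\<close> the right-hand side vanishes because
  \<open>\<Delta> x = 0\<close>, so right multiplication by \<open>x\<close> has to annihilate all products.  For \<open>y\<close> the law
  says that right multiplication by \<open>y\<close> respects products.  Both conditions are bilinear in the two
  other arguments.
\<close>
lemma self_distributive_bialgebra_criterion:
  assumes vs: "vectorspace K A" and x: "x \<in> carrier A" and y: "y \<in> carrier A"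
    and gen: "module.span K A {x, y} = carrier A"
    and \<Delta>: "\<Delta> \<in> module_hom K A (tensor K A A)"
    and \<Delta>x: "\<Delta> x = \<zero>\<^bsub>tensor K A A\<^esub>" and \<Delta>y: "\<Delta> y = pure_tensor K A A y y"
    and \<mu>: "bilinear_map K A A A \<mu>"
    and \<Delta>\<mu>_zero: "\<Delta> (\<mu> x x) = \<zero>\<^bsub>tensor K A A\<^esub>" "\<Delta> (\<mu> x y) = \<zero>\<^bsub>tensor K A A\<^esub>"
      "\<Delta> (\<mu> y x) = \<zero>\<^bsub>tensor K A A\<^esub>"
    and \<Delta>\<mu>_yy: "\<Delta> (\<mu> y y) = pure_tensor K A A (\<mu> y y) (\<mu> y y)"
    and right_x: "\<And>s t. s \<in> {x, y} \<Longrightarrow> t \<in> {x, y} \<Longrightarrow> \<mu> (\<mu> s t) x = \<zero>\<^bsub>A\<^esub>"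
    and right_y: "\<And>s t. s \<in> {x, y} \<Longrightarrow> t \<in> {x, y} \<Longrightarrow> \<mu> (\<mu> s t) y = \<mu> (\<mu> s y) (\<mu> t y)"
  shows "self_distributive_bialgebra K A \<mu> \<Delta>"
proof -
  interpret vectorspace K A by (rule vs)
  have A: "module K A" by (rule module.module_axioms)
  interpret AA: tensor_product K A A using A A by (rule tensor_product.intro)
  have T: "module K (tensor K A A)" by (rule AA.tensor_module)
  have AT: "module K (tensor K A (tensor K A A))" by (rule tensor_module[OF A T])
  have xy: "{x, y} \<subseteq> carrier A" using x y by simp
  note hom_eq = module_hom_eq_on_span[OF A _ _ _ xy, unfolded gen]
  note bilinear_eq = bilinear_eq_on_span[OF A A _ _ _ xy xy, unfolded gen]
  note \<mu>_closed = bilinear_carrier[OF \<mu>]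
  have coassoc: "coassociative K A \<Delta>"
    unfolding coassociative_def
  proof
    fix a assume a: "a \<in> carrier A"
    let ?l = "\<lambda>t. tensor_assoc K A A A (tensor_map K A A (tensor K A A) A \<Delta> id t)"
    let ?r = "tensor_map K A A A (tensor K A A) id \<Delta>"
    have l: "?l \<in> module_hom K (tensor K A A) (tensor K A (tensor K A A))"
      by (rule module_hom_compose[OF tensor_map_hom[OF A A T A \<Delta> module_hom_id]
            tensor_assoc_hom[OF A A A]])
    have r: "?r \<in> module_hom K (tensor K A A) (tensor K A (tensor K A A))"
      by (rule tensor_map_hom[OF A A A T module_hom_id \<Delta>])
    have "?l (\<Delta> x) = ?r (\<Delta> x)"
      unfolding \<Delta>x using module_hom_zero[OF T AT l] module_hom_zero[OF T AT r] by simp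
    moreover have "?l (\<Delta> y) = ?r (\<Delta> y)"
      unfolding \<Delta>y using y
      by (simp add: tensor_map_pure[OF A A T A \<Delta> module_hom_id] \<Delta>y
          tensor_map_pure[OF A A A T module_hom_id \<Delta>] tensor_assoc_pure[OF A A A])
    ultimately show "?l (\<Delta> a) = ?r (\<Delta> a)"
      by (intro hom_eq[OF AT module_hom_compose[OF \<Delta> l] module_hom_compose[OF \<Delta> r] _ a]) auto
  qed
  note tm = tensor_mult_bilinear[OF A \<mu>]
  note tm_zero = bilinear_zero[OF T T T tm]
  have comult_mult: "\<Delta> (\<mu> a b) = tensor_mult K A \<mu> (\<Delta> a) (\<Delta> b)"
    if "a \<in> carrier A" "b \<in> carrier A" for a b
  proof (rule bilinear_eq[OF T module_hom_bilinear[OF \<mu> \<Delta>] bilinear_compose[OF tm \<Delta> \<Delta>] _ that])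
    fix s t assume "s \<in> {x, y}" "t \<in> {x, y}"
    then show "\<Delta> (\<mu> s t) = tensor_mult K A \<mu> (\<Delta> s) (\<Delta> t)"
      using y by (auto simp: \<Delta>x \<Delta>y \<Delta>\<mu>_zero \<Delta>\<mu>_yy tm_zero tensor_mult_pure[OF A \<mu>])
  qed
  have self_dist: "\<mu> (\<mu> a b) c = tensor_lift K A A A (\<lambda>u v. \<mu> (\<mu> a u) (\<mu> b v)) (\<Delta> c)"
    if a: "a \<in> carrier A" and b: "b \<in> carrier A" and c: "c \<in> carrier A" for a b c
  proof -
    have right: "bilinear_map K A A A (\<lambda>a b. \<mu> (\<mu> a b) z)" if "z \<in> carrier A" for z
      by (rule module_hom_bilinear[OF \<mu> bilinear_homs(2)[OF \<mu> that]])
    have zero: "bilinear_map K A A A (\<lambda>a b. \<zero>\<^bsub>A\<^esub>)"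
      by (intro bilinear_mapI module_hom_const_zero A)
    have at_x: "\<mu> (\<mu> a b) x = \<zero>\<^bsub>A\<^esub>"
      by (rule bilinear_eq[OF A right[OF x] zero right_x a b])
    have at_y: "\<mu> (\<mu> a b) y = \<mu> (\<mu> a y) (\<mu> b y)"
      by (rule bilinear_eq[OF A right[OF y] bilinear_compose[OF \<mu> bilinear_homs(2)[OF \<mu> y]
              bilinear_homs(2)[OF \<mu> y]] right_y a b])
    have f: "bilinear_map K A A A (\<lambda>u v. \<mu> (\<mu> a u) (\<mu> b v))"
      by (rule bilinear_compose[OF \<mu> bilinear_homs(1)[OF \<mu> a] bilinear_homs(1)[OF \<mu> b]])
    let ?lift = "tensor_lift K A A A (\<lambda>u v. \<mu> (\<mu> a u) (\<mu> b v))"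
    have lift: "?lift \<in> module_hom K (tensor K A A) A" by (rule AA.tensor_lift_hom[OF A f])
    show ?thesis
    proof (rule hom_eq[OF A _ module_hom_compose[OF \<Delta> lift] _ c])
      show "\<mu> (\<mu> a b) \<in> module_hom K A A" by (rule bilinear_homs(1)[OF \<mu> \<mu>_closed[OF a b]])
      fix s assume "s \<in> {x, y}"
      then show "\<mu> (\<mu> a b) s = ?lift (\<Delta> s)"
        using y module_hom_zero[OF T A lift]
        by (auto simp: \<Delta>x \<Delta>y at_x at_y AA.tensor_lift_pure[OF A f])
    qed
  qed
  show ?thesis
    by (intro self_distributive_bialgebra.intro bialgebra.intro bialgebra_axioms.intro
        self_distributive_bialgebra_axioms.intro vs \<mu> \<Delta> coassoc comult_mult self_dist)
qed

section \<open>The two families of multiplications\<close>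

theorem proposition3p7:
  fixes K :: "('k, 'm) ring_scheme"
    and A :: "('k, 'a, 'n) module_scheme"
    and x y :: 'a
    and \<Delta> :: "'a \<Rightarrow> ('a \<times> 'a \<Rightarrow> 'k) set"
  assumes "vectorspace K A"
    and "x \<noteq> y"
    and "vectorspace.basis K A {x, y}"
    and "\<Delta> \<in> module_hom K A (tensor K A A)"
    and "\<Delta> x = \<zero>\<^bsub>tensor K A A\<^esub>"
    and "\<Delta> y = pure_tensor K A A y y"
  shows
    "(\<forall>b\<in>carrier K. \<forall>\<mu>.
        bilinear_map K A A A \<mu> \<and>
        \<mu> x x = \<zero>\<^bsub>A\<^esub> \<and> \<mu> x y = \<zero>\<^bsub>A\<^esub> \<and> \<mu> y x = b \<odot>\<^bsub>A\<^esub> x \<and> \<mu> y y = \<zero>\<^bsub>A\<^esub> \<longrightarrow>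
        self_distributive_bialgebra K A \<mu> \<Delta> \<and> \<not> counital K A \<Delta>)
     \<and>
     (\<forall>c\<in>carrier K. \<forall>\<mu>.
        bilinear_map K A A A \<mu> \<and>
        \<mu> x x = \<zero>\<^bsub>A\<^esub> \<and> \<mu> x y = c \<odot>\<^bsub>A\<^esub> x \<and> \<mu> y x = \<zero>\<^bsub>A\<^esub> \<and> \<mu> y y = y \<longrightarrow>
        self_distributive_bialgebra K A \<mu> \<Delta> \<and> \<not> counital K A \<Delta>)"
proof -
  interpret vectorspace K A by (rule assms(1))
  have A: "module K A" by (rule module.module_axioms)
  interpret AA: tensor_product K A A using A A by (rule tensor_product.intro)
  have basis: "lin_indpt {x, y}" "span {x, y} = carrier A" "{x, y} \<subseteq> carrier A"
    using assms(3) by (auto simp: basis_def)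
  have x: "x \<in> carrier A" and y: "y \<in> carrier A" using basis(3) by auto
  have x_nonzero: "x \<noteq> \<zero>\<^bsub>A\<^esub>" using vs_zero_lin_dep[OF basis(3,1)] by auto
  note \<Delta> = assms(4-6)
  note criterion = self_distributive_bialgebra_criterion[OF assms(1) x y basis(2) \<Delta>]
  have \<Delta>_zero: "\<Delta> \<zero>\<^bsub>A\<^esub> = \<zero>\<^bsub>tensor K A A\<^esub>"
    by (rule module_hom_zero[OF A AA.tensor_module \<Delta>(1)])
  have \<Delta>_smult_x: "\<Delta> (r \<odot>\<^bsub>A\<^esub> x) = \<zero>\<^bsub>tensor K A A\<^esub>" if "r \<in> carrier K" for r
    using that x by (simp add: module_hom_smult[OF \<Delta>(1)] \<Delta>(2))
  note pure_zero = bilinear_zero(1)[OF A A AA.tensor_module AA.pure_tensor_bilinear]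
  have not_counital: "\<not> counital K A \<Delta>"
    by (rule not_counital_if_comult_kernel[where \<Delta> = \<Delta>, OF A x x_nonzero \<Delta>(2)])
  show ?thesis
  proof (intro conjI ballI allI impI not_counital; elim conjE)
    \<comment> \<open>All products lie in the span of \<open>x\<close>, which \<open>\<Delta>\<close> and both right multiplications kill.\<close>
    fix b \<mu> assume b: "b \<in> carrier K" and \<mu>: "bilinear_map K A A A \<mu>"
      and tab: "\<mu> x x = \<zero>\<^bsub>A\<^esub>" "\<mu> x y = \<zero>\<^bsub>A\<^esub>" "\<mu> y x = b \<odot>\<^bsub>A\<^esub> x" "\<mu> y y = \<zero>\<^bsub>A\<^esub>"
    note zero = bilinear_zero[OF A A A \<mu>]
    note smult = module_hom_smult[OF bilinear_homs(2)[OF \<mu>] b x]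
    show "self_distributive_bialgebra K A \<mu> \<Delta>"
      by (rule criterion[OF \<mu>])
        (use b x y in \<open>auto simp: tab zero smult \<Delta>_zero \<Delta>_smult_x pure_zero\<close>)
  next
    \<comment> \<open>Right multiplication by \<open>x\<close> is zero; right multiplication by \<open>y\<close> is the endomorphism
      \<open>x \<mapsto> c x\<close>, \<open>y \<mapsto> y\<close>.\<close>
    fix c \<mu> assume c: "c \<in> carrier K" and \<mu>: "bilinear_map K A A A \<mu>"
      and tab: "\<mu> x x = \<zero>\<^bsub>A\<^esub>" "\<mu> x y = c \<odot>\<^bsub>A\<^esub> x" "\<mu> y x = \<zero>\<^bsub>A\<^esub>" "\<mu> y y = y"
    note zero = bilinear_zero[OF A A A \<mu>]
    note smult = module_hom_smult[OF bilinear_homs(1)[OF \<mu>] c x]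
      module_hom_smult[OF bilinear_homs(2)[OF \<mu>] c x]
    show "self_distributive_bialgebra K A \<mu> \<Delta>"
      by (rule criterion[OF \<mu>])
        (use c x y in \<open>auto simp: tab zero smult \<Delta>_zero \<Delta>_smult_x \<Delta>(3)\<close>)
  qed
qed

end
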